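(* Let $p$ be a prime, let $d$ be a positive integer properly dividing $p-1$ (that is, $d \mid p-1$ and $d\neq p-1$), and suppose $A \subseteq \mathbb{F}_p$ is such that $A - A \subseteq Z_d \cup \{0\}$, where $Z_d = \{z \in \mathbb{F}_p : z^d = 1\}$. Then \[ |A|(|A|-1) \leq d. \] In particular, for every prime $p \equiv 1 \pmod 4$, the clique number $\omega(G_p)$ of the Paley graph $G_p$ satisfies \[ \omega(G_p) \leq \frac{\sqrt{2p-1}+1}{2}. \]
   Context: $\mathbb{F}_p$ is the field with $p$ elements. For $A\subseteq \mathbb{F}_p$, $A-A=\{a-a' : a,a'\in A\}$. For a prime $p\equiv 1 \pmod 4$, the Paley graph $G_p$ is the Cayley graph on the additive group $\mathbb{F}_p$ generated by the nonzero quadratic residues: its vertex set is $\mathbb{F}_p$, and distinct $x,y$ are adjacent if and only if $x-y$ is a nonzero square in $\mathbb{F}_p$. The clique number $\omega(G)$ of a graph $G$ is the largest size of a set of pairwise adjacent vertices. *)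

theory Defs
  imports
    Complex_Main
    "HOL-Number_Theory.Number_Theory"
    "Berlekamp_Zassenhaus.Finite_Field"
    "Graph_Theory.Pair_Digraph"
begin

text \<open>
  The field with \<open>p\<close> elements is \<^typ>\<open>'p::prime_card mod_ring\<close>, where \<open>p = CARD('p)\<close> is prime
  by the class constraint.
\<close>

definition difference_set :: "'a::ab_group_add set \<Rightarrow> 'a set" where
  "difference_set A = {a - a' |a a'. a \<in> A \<and> a' \<in> A}"

definition Z :: "nat \<Rightarrow> 'a::field set" where
  "Z d = {z. z ^ d = 1}"

text \<open>
  Undirected graphs are represented, as usual in \<^theory>\<open>Graph_Theory.Digraph\<close>, by symmetric
  loop-free digraphs; a clique is accordingly required to have arcs in both directions between
  any two of its vertices.
\<close>

definition is_clique :: "'a pair_pre_digraph \<Rightarrow> 'a set \<Rightarrow> bool" where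
  "is_clique G K \<longleftrightarrow>
     K \<subseteq> pverts G \<and> (\<forall>x\<in>K. \<forall>y\<in>K. x \<noteq> y \<longrightarrow> (x, y) \<in> parcs G)"

text \<open>Meaningful when the vertex set is finite; the empty clique makes the set nonempty.\<close>

definition clique_number :: "'a pair_pre_digraph \<Rightarrow> nat" where
  "clique_number G = Max {card K |K. is_clique G K}"

definition cayley_graph :: "'a::ab_group_add set \<Rightarrow> 'a pair_pre_digraph" where
  "cayley_graph S = \<lparr>pverts = UNIV, parcs = {(x, y). x - y \<in> S}\<rparr>"

definition nonzero_squares :: "'a::field set" where
  "nonzero_squares = {z. z \<noteq> 0 \<and> (\<exists>y. z = y ^ 2)}"

definition paley_graph :: "'p::prime_card mod_ring pair_pre_digraph" where
  "paley_graph = cayley_graph nonzero_squares"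

text \<open>The congruence condition is what makes the Paley graph undirected.\<close>

lemma pair_graph_paley_graph:
  assumes "[CARD('p) = 1] (mod 4)"
  shows "pair_graph (paley_graph :: 'p::prime_card mod_ring pair_pre_digraph)"
proof -
  let ?p = "CARD('p)"
  have p: "prime ?p" by (rule prime_card)
  have p4: "?p mod 4 = 1" using assms by (simp add: cong_def)
  have p2: "?p > 2" using p4 prime_gt_1_nat[OF p] by (cases "?p = 2") auto
  have ev: "even ((?p - 1) div 2)" using p4 by presburger
  have "[Legendre (-1) (int ?p) = (-1) ^ ((?p - 1) div 2)] (mod int ?p)"
    by (rule euler_criterion[OF p p2])
  hence "[Legendre (-1) (int ?p) = 1] (mod int ?p)" using ev by simp
  moreover have "\<not> [0 = 1] (mod int ?p)" "\<not> [-1 = 1] (mod int ?p)"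
    using p2 by (auto simp: cong_iff_dvd_diff dest: zdvd_imp_le)
  ultimately have "QuadRes (int ?p) (-1)"
    by (auto simp: Legendre_def split: if_splits)
  then obtain y where "[y ^ 2 = -1] (mod int ?p)" by (auto simp: QuadRes_def)
  hence "(of_int (y ^ 2) :: 'p mod_ring) = of_int (-1)"
    by (subst of_int_eq_iff_cong_CHAR) simp
  hence y: "(of_int y :: 'p mod_ring) ^ 2 = -1" by simp
  have neg: "- z \<in> nonzero_squares" if "z \<in> nonzero_squares" for z :: "'p mod_ring"
  proof -
    from that obtain w where w: "z \<noteq> 0" "z = w ^ 2" by (auto simp: nonzero_squares_def)
    have "- z = (of_int y * w) ^ 2" using y w by (simp add: power_mult_distrib)
    thus ?thesis using w(1) by (auto simp: nonzero_squares_def)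
  qed
  show ?thesis
  proof
    show "symmetric (with_proj (paley_graph :: 'p mod_ring pair_pre_digraph))"
      using neg by (force simp: symmetric_def sym_def paley_graph_def cayley_graph_def)
  qed (auto simp: paley_graph_def cayley_graph_def nonzero_squares_def)
qed

end

(*
  Stepanov's method, after Hanson and Petridis. Let n = |A| and let w(a) be the Lagrange weights
  of A, so that the sum of w(a) q(a) over A is the coefficient of x^(n-1) in q whenever
  deg q < n. Consider

    F(x) = (sum over a in A of w(a) (x - a)^(d+n-1)) - (-1)^(n-1).

  The vanishing of the low moments of w leaves a polynomial of degree at most d, whose x^d
  coefficient is, up to sign, the binomial coefficient (d+n-1 choose d). This is nonzero mod p
  because n <= d + 1 and 2 d <= p - 1 force d + n - 1 < p. On the other hand, every
  b in A is a root of multiplicity at least n - 1: in the expansion of F around b, the factor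
  (b - a)^d may be dropped from (b - a)^(d+j) for j > 0, and the same moments vanish again.
  Counting roots gives n (n - 1) <= d.
*)

theory Submission
  imports Defs
begin

section \<open>Lagrange interpolation and the moments of its weights\<close>

definition lagrange_weight :: "'a::field set \<Rightarrow> 'a \<Rightarrow> 'a" where
  "lagrange_weight A a = inverse (\<Prod>b\<in>A - {a}. a - b)"

text \<open>Interpolation recovers \<open>q\<close> from its values on \<open>A\<close>. The
  unnormalised basis polynomials \<open>L a\<close> are monic of degree \<open>card A - 1\<close>,
  so comparing coefficients there leaves exactly the weighted sum.\<close>

lemma sum_lagrange_weight_poly:
  fixes A :: "'a::field set"
  assumes "finite A" "degree q < card A"
  shows "(\<Sum>a\<in>A. lagrange_weight A a * poly q a) = poly.coeff q (card A - 1)"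
proof -
  define L where "L a = (\<Prod>b\<in>A - {a}. [:-b, 1:])" for a
  define r where "r = (\<Sum>a\<in>A. smult (lagrange_weight A a * poly q a) (L a))"
  have deg_L: "degree (L a) = card A - 1" if "a \<in> A" for a
    unfolding L_def using that assms(1) by (subst degree_prod_sum_eq) auto
  have coeff_L: "poly.coeff (L a) (card A - 1) = 1" if "a \<in> A" for a
  proof -
    have "lead_coeff (L a) = 1"
      unfolding L_def by (subst lead_coeff_prod) simp
    thus ?thesis by (simp add: deg_L that)
  qed
  have "q = r"
  proof (rule poly_eqI_degree)
    show "poly q x = poly r x" if "x \<in> A" for x
    proof -
      have "poly r x = (\<Sum>a\<in>A. lagrange_weight A a * poly q a * poly (L a) x)"
        by (simp add: r_def poly_sum)
      also have "\<dots> = (\<Sum>a\<in>{x}. lagrange_weight A a * poly q a * poly (L a) x)"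
      proof (rule sum.mono_neutral_right)
        show "\<forall>a\<in>A - {x}. lagrange_weight A a * poly q a * poly (L a) x = 0"
          using assms(1) that by (auto simp: L_def poly_prod)
      qed (use assms(1) that in auto)
      also have "\<dots> = poly q x"
        using assms(1) by (simp add: L_def poly_prod lagrange_weight_def)
      finally show ?thesis ..
    qed
    have "degree r \<le> card A - 1"
      unfolding r_def by (rule degree_sum_le) (use assms(1) deg_L in auto)
    thus "degree r < card A" using assms(2) by linarith
  qed (rule assms(2))
  hence "poly.coeff q (card A - 1) = poly.coeff r (card A - 1)" by simp
  also have "\<dots> = (\<Sum>a\<in>A. lagrange_weight A a * poly q a)"
    by (simp add: r_def coeff_sum coeff_L del: One_nat_def)
  finally show ?thesis ..
qed

text \<open>Interpolate \<open>(b - x) ^ k\<close>: its leading coefficient \<open>(-1) ^ k\<close>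
  sits in degree \<open>k\<close>, so only the top moment survives.\<close>

lemma sum_lagrange_weight_power_diff:
  fixes A :: "'a::field set"
  assumes "finite A" "k < card A"
  shows "(\<Sum>a\<in>A. lagrange_weight A a * (b - a) ^ k) = (if k = card A - 1 then (-1) ^ k else 0)"
proof -
  have deg: "degree ([:b, -1:] ^ k) = k" by (simp add: degree_power_eq)
  have "(\<Sum>a\<in>A. lagrange_weight A a * (b - a) ^ k)
      = (\<Sum>a\<in>A. lagrange_weight A a * poly ([:b, -1:] ^ k) a)"
    by simp
  also have "\<dots> = poly.coeff ([:b, -1:] ^ k) (card A - 1)"
    by (rule sum_lagrange_weight_poly) (use assms deg in auto)
  also have "\<dots> = (if k = card A - 1 then (-1) ^ k else 0)"
    using assms(2) deg by (auto intro: coeff_eq_0)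
  finally show ?thesis .
qed

section \<open>Roots counted with multiplicity\<close>

lemma sum_le_degree_if_linear_power_dvd:
  fixes p :: "'a::field poly"
  assumes "p \<noteq> 0" "\<And>x. x \<in> A \<Longrightarrow> [:-x, 1:] ^ m dvd p"
  shows "card A * m \<le> degree p"
proof (cases "m = 0")
  case False
  have root: "poly p x = 0" if "x \<in> A" for x
    using assms(2)[OF that] False by (auto simp: dvd_def)
  have "card A * m = (\<Sum>x\<in>A. m)" by simp
  also have "\<dots> \<le> (\<Sum>x\<in>A. Polynomial.order x p)"
    using assms by (intro sum_mono) (auto simp: order_divides)
  also have "\<dots> \<le> (\<Sum>x | poly p x = 0. Polynomial.order x p)"
    using root assms(1) by (intro sum_mono2) (auto intro: poly_roots_finite)
  also have "\<dots> \<le> degree p" by (rule sum_order_le_degree[OF assms(1)])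
  finally show ?thesis .
qed auto

lemma pcompose_power: "pcompose (p ^ n) q = pcompose p q ^ n"
  by (induction n) (simp_all add: pcompose_1 pcompose_mult)

text \<open>Translate \<open>x\<close> to the origin, where divisibility by a power of the variable
  is read off the low coefficients, and translate back. Without derivatives, no factorial has to be
  invertible.\<close>

lemma linear_power_dvd_if_coeff_pcompose_0:
  fixes p :: "'a::field poly"
  assumes "\<And>k. k < m \<Longrightarrow> poly.coeff (pcompose p [:x, 1:]) k = 0"
  shows "[:-x, 1:] ^ m dvd p"
proof -
  have "monom 1 m dvd pcompose p [:x, 1:]"
    using assms by (simp add: monom_1_dvd_iff')
  then obtain r where r: "pcompose p [:x, 1:] = [:0, 1:] ^ m * r"
    by (auto simp: monom_altdef dvd_def)
  have "p = pcompose (pcompose p [:x, 1:]) [:-x, 1:]"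
    by (simp flip: pcompose_assoc add: pcompose_pCons)
  also have "\<dots> = [:-x, 1:] ^ m * pcompose r [:-x, 1:]"
    by (simp add: r pcompose_mult pcompose_power pcompose_pCons)
  finally show ?thesis by simp
qed

section \<open>The Stepanov bound over a field\<close>

lemma diff_in_difference_set: "a \<in> A \<Longrightarrow> b \<in> A \<Longrightarrow> a - b \<in> difference_set A"
  by (auto simp: difference_set_def)

text \<open>Positivity of \<open>j\<close> covers \<open>z = 0\<close>, where both powers must
  vanish.\<close>

lemma power_add_root_of_unity_or_0:
  "z \<in> Z d \<union> {0} \<Longrightarrow> j > 0 \<Longrightarrow> z ^ (d + j) = z ^ j"
  by (auto simp: Z_def power_add)

text \<open>The characteristic enters only through \<open>binom\<close>, which keeps the auxiliary
  polynomial nonzero.\<close>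

lemma stepanov_bound:
  fixes A :: "'a::field set"
  assumes "finite A" "d > 0" "difference_set A \<subseteq> Z d \<union> {0}"
    and binom: "of_nat ((d + (card A - 1)) choose d) \<noteq> (0::'a)"
  shows "card A * (card A - 1) \<le> d"
proof (cases "card A \<le> 1")
  case True
  hence "card A = 0 \<or> card A = 1" by linarith
  thus ?thesis by auto
next
  case False
  define m where "m = card A - 1"
  have m: "m > 0" "card A = Suc m" using False by (auto simp: m_def)
  define w where "w = lagrange_weight A"
  have moment: "(\<Sum>a\<in>A. w a * (b - a) ^ k) = (if k = m then (-1) ^ k else 0)" if "k \<le> m" for b k
    unfolding w_def using sum_lagrange_weight_power_diff[OF assms(1), of k b] that m by simp
  \<comment> \<open>\<open>F 0\<close> is the auxiliary polynomial and \<open>F b\<close> its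
    translate, whose coefficients are the Taylor coefficients of \<open>F 0\<close> at
    \<open>b\<close>.\<close>
  define F where "F b = (\<Sum>a\<in>A. smult (w a) ([:b - a, 1:] ^ (d + m))) - [:(-1) ^ m:]" for b
  have pcompose_F: "pcompose (F 0) [:b, 1:] = F b" for b
    by (simp add: F_def pcompose_diff pcompose_sum pcompose_smult pcompose_power pcompose_pCons)
  have coeff_F: "poly.coeff (F b) k = of_nat ((d + m) choose k) * (\<Sum>a\<in>A. w a * (b - a) ^ (d + m - k))
                   - (if k = 0 then (-1) ^ m else 0)"  if "k \<le> d + m" for b k
    using that
    by (auto simp: F_def coeff_sum coeff_linear_poly_power sum_distrib_left mult_ac
             coeff_pCons split: nat.splits)
  \<comment> \<open>Index \<open>d\<close> picks out the moment of order \<open>m\<close>, the first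
    nonzero one; \<open>d > 0\<close> keeps the subtracted constant away.\<close>
  have "poly.coeff (F 0) d = of_nat ((d + m) choose d) * (-1) ^ m"
    using \<open>d > 0\<close> using moment[of m 0] by (subst coeff_F) simp_all
  moreover have "of_nat ((d + m) choose d) \<noteq> (0::'a)"
    using binom m by simp
  ultimately have "F 0 \<noteq> 0" by auto
  have "degree (F 0) \<le> d"
  proof (rule degree_le, intro allI impI)
    fix k assume "d < k"
    show "poly.coeff (F 0) k = 0"
    \<comment> \<open>Up to \<open>d + m\<close> the moment has order below \<open>m\<close>, hence
      vanishes; beyond that the degree of the summands is exceeded.\<close>
    proof (cases "k \<le> d + m")
      case True
      thus ?thesis using \<open>d < k\<close> moment[of "d + m - k" 0] by (subst coeff_F) auto
    next
      case False
      have "degree (F 0) \<le> d + m"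
        unfolding F_def
        by (intro degree_diff_le degree_sum_le order.trans[OF degree_smult_le])
           (simp_all add: assms(1) degree_linear_power)
      thus ?thesis using False by (intro coeff_eq_0) auto
    qed
  qed
  have "[:-b, 1:] ^ m dvd F 0" if "b \<in> A" for b
  proof (rule linear_power_dvd_if_coeff_pcompose_0)
    fix k assume "k < m"
    \<comment> \<open>As \<open>k < m\<close>, the exponent \<open>m - k\<close> is positive, so
      \<open>a = b\<close> is included.\<close>
    have pow: "(b - a) ^ (d + m - k) = (b - a) ^ (m - k)" if "a \<in> A" for a
    proof -
      have "b - a \<in> Z d \<union> {0}"
        using assms(3) diff_in_difference_set[OF \<open>b \<in> A\<close> that] by blast
      hence "(b - a) ^ (d + (m - k)) = (b - a) ^ (m - k)"
        by (rule power_add_root_of_unity_or_0) (use \<open>k < m\<close> in simp)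
      thus ?thesis using \<open>k < m\<close> by simp
    qed
    have "(\<Sum>a\<in>A. w a * (b - a) ^ (d + m - k)) = (\<Sum>a\<in>A. w a * (b - a) ^ (m - k))"
      by (simp add: pow)
    \<comment> \<open>The order \<open>m - k\<close> reaches \<open>m\<close> only for
      \<open>k = 0\<close>, where the moment cancels the constant subtracted in
      \<open>F\<close>.\<close>
    also have "\<dots> = (if k = 0 then (-1) ^ m else 0)"
      using \<open>k < m\<close> by (subst moment) auto
    finally show "poly.coeff (pcompose (F 0) [:b, 1:]) k = 0"
      using \<open>k < m\<close> by (simp add: pcompose_F coeff_F)
  qed
  hence "card A * m \<le> degree (F 0)"
    by (rule sum_le_degree_if_linear_power_dvd[OF \<open>F 0 \<noteq> 0\<close>])
  thus ?thesis using \<open>degree (F 0) \<le> d\<close> by (simp add: m_def)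
qed

section \<open>Roots of unity and the bound in prime fields\<close>

lemma card_roots_of_unity_le:
  assumes "d > 0"
  shows "finite (Z d :: 'a::field set)" "card (Z d :: 'a set) \<le> d"
proof -
  define q :: "'a poly" where "q = monom 1 d - 1"
  have "poly.coeff q d = 1" using assms by (simp add: q_def)
  hence "q \<noteq> 0" by auto
  moreover have "degree q \<le> d"
    unfolding q_def by (intro degree_diff_le) (auto simp: degree_monom_le)
  moreover have Z: "Z d = {x. poly q x = 0}" by (auto simp: Z_def q_def poly_monom)
  ultimately show "finite (Z d :: 'a set)" "card (Z d :: 'a set) \<le> d"
    using poly_roots_finite card_poly_roots_bound[of q] by auto
qed

text \<open>Translating \<open>A\<close> by one of its elements puts it inside
  \<open>Z d \<union> {0}\<close>. This crude bound serves to keep \<open>d + (card A - 1)\<close>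
  below the characteristic.\<close>

lemma card_le_if_difference_set_subset:
  fixes A :: "'a::field set"
  assumes "d > 0" "difference_set A \<subseteq> Z d \<union> {0}"
  shows "card A \<le> Suc d"
proof (cases "A = {}")
  case False
  then obtain b where "b \<in> A" by auto
  have "card A = card ((\<lambda>a. a - b) ` A)"
    by (intro card_image[symmetric]) (auto simp: inj_on_def)
  also have "\<dots> \<le> card (insert 0 (Z d :: 'a set))"
    using assms(2) \<open>b \<in> A\<close> card_roots_of_unity_le(1)[OF assms(1)]
    by (intro card_mono) (auto dest: diff_in_difference_set)
  also have "\<dots> \<le> Suc (card (Z d :: 'a set))" by (rule card_insert_le_m1) auto
  also have "\<dots> \<le> Suc d" using card_roots_of_unity_le(2)[OF assms(1)] by simp
  finally show ?thesis .
qed auto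

lemma card_difference_set_bound:
  fixes A :: "'p::prime_card mod_ring set"
  assumes "d > 0" "d dvd CARD('p) - 1" "d \<noteq> CARD('p) - 1" "difference_set A \<subseteq> Z d \<union> {0}"
  shows "card A * (card A - 1) \<le> d"
proof (rule stepanov_bound)
  have p: "prime CARD('p)" by (rule prime_card)
  have "2 * d \<le> CARD('p) - 1"
  proof -
    obtain e where e: "CARD('p) - 1 = d * e" using assms(2) by (elim dvdE)
    have "e \<noteq> 0" using e prime_gt_1_nat[OF p] by (intro notI) simp
    moreover have "e \<noteq> 1" using e assms(3) by auto
    ultimately have "e \<ge> 2" by linarith
    thus ?thesis using e by simp
  qed
  moreover have "card A \<le> Suc d"
    by (rule card_le_if_difference_set_subset) (use assms in auto)
  ultimately have lt: "d + (card A - 1) < CARD('p)" using prime_gt_1_nat[OF p] by linarith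
  show "of_nat ((d + (card A - 1)) choose d) \<noteq> (0 :: 'p mod_ring)"
  proof -
    \<comment> \<open>A prime divides no factorial of a smaller number, and the binomial coefficient
      divides this one.\<close>
    have "\<not> CARD('p) dvd fact (d + (card A - 1))"
      using lt p by (simp add: prime_dvd_fact_iff)
    hence "\<not> CARD('p) dvd ((d + (card A - 1)) choose d)"
      using binomial_fact_lemma[of d "d + (card A - 1)"] by (metis dvd_triv_right dvd_trans le_add1)
    thus ?thesis by (simp add: of_nat_eq_0_iff_char_dvd)
  qed
qed (use assms in auto)

section \<open>Cliques of the Paley graph\<close>

lemma clique_number_attained:
  assumes "finite (pverts G)"
  obtains K where "is_clique G K" "card K = clique_number G"
proof -
  have "finite {K. is_clique G K}"
    by (rule finite_subset[of _ "Pow (pverts G)"]) (use assms in \<open>auto simp: is_clique_def\<close>)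
  hence "finite {card K |K. is_clique G K}" by simp
  moreover have "is_clique G {}" by (simp add: is_clique_def)
  ultimately have "clique_number G \<in> {card K |K. is_clique G K}"
    unfolding clique_number_def by (intro Max_in) auto
  thus ?thesis using that by auto
qed

text \<open>A nonzero difference is some \<open>u ^ 2\<close>, and raising it to half of
  \<open>CARD('p) - 1\<close> gives 1 by Fermat; oddness makes the halving exact.\<close>

lemma difference_set_paley_clique:
  fixes K :: "'p::prime_card mod_ring set"
  assumes "odd CARD('p)" "is_clique paley_graph K"
  shows "difference_set K \<subseteq> Z ((CARD('p) - 1) div 2) \<union> {0}"
proof
  fix z assume "z \<in> difference_set K"
  then obtain x y where xy: "x \<in> K" "y \<in> K" "z = x - y" by (auto simp: difference_set_def)
  show "z \<in> Z ((CARD('p) - 1) div 2) \<union> {0}"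
  proof (cases "x = y")
    case False
    hence "z \<in> nonzero_squares"
      using assms(2) xy by (auto simp: is_clique_def paley_graph_def cayley_graph_def)
    then obtain u where u: "z = u ^ 2" "u \<noteq> 0" by (auto simp: nonzero_squares_def)
    have "u * u ^ (CARD('p) - 1) = u ^ CARD('p)"
      by (simp flip: power_Suc)
    also have "\<dots> = u" using finite_field_power_card_eq_same[of u] by simp
    finally have "u ^ (CARD('p) - 1) = 1" using u(2) by simp
    moreover have "2 * ((CARD('p) - 1) div 2) = CARD('p) - 1" using assms(1) by simp
    ultimately show ?thesis by (simp add: Z_def u(1) flip: power_mult)
  qed (use xy in auto)
qed

lemma paley_clique_number_bound:
  assumes "CARD('p::prime_card) > 2"
  defines "n \<equiv> clique_number (paley_graph :: 'p mod_ring pair_pre_digraph)"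
  shows "n * (n - 1) \<le> (CARD('p) - 1) div 2"
proof -
  let ?d = "(CARD('p) - 1) div 2"
  have odd: "odd CARD('p)" using prime_odd_nat[OF prime_card] assms(1) by blast
  obtain K :: "'p mod_ring set" where K: "is_clique paley_graph K" "card K = n"
    unfolding n_def by (rule clique_number_attained[of "paley_graph :: 'p mod_ring pair_pre_digraph"]) auto
  have "card K * (card K - 1) \<le> ?d"
  proof (rule card_difference_set_bound)
    show "?d dvd CARD('p) - 1" using odd by (intro div_dvd_iff_mult[THEN iffD2]) auto
  qed (use assms(1) odd difference_set_paley_clique[OF odd K(1)] in auto)
  thus ?thesis by (simp add: K)
qed

theorem corollary1p5:
  shows "(\<forall>(d::nat) (A :: 'p::prime_card mod_ring set).
            d > 0 \<longrightarrow> d dvd CARD('p) - 1 \<longrightarrow> d \<noteq> CARD('p) - 1 \<longrightarrow>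
            difference_set A \<subseteq> Z d \<union> {0} \<longrightarrow>
            int (card A) * (int (card A) - 1) \<le> int d)
       \<and> ([CARD('p) = 1] (mod 4) \<longrightarrow>
            real (clique_number (paley_graph :: 'p mod_ring pair_pre_digraph))
              \<le> (sqrt (2 * real CARD('p) - 1) + 1) / 2)"
proof (intro conjI allI impI)
  fix d :: nat and A :: "'p mod_ring set"
  assume "d > 0" "d dvd CARD('p) - 1" "d \<noteq> CARD('p) - 1" "difference_set A \<subseteq> Z d \<union> {0}"
  hence "int (card A * (card A - 1)) \<le> int d"
    by (intro of_nat_mono card_difference_set_bound)
  thus "int (card A) * (int (card A) - 1) \<le> int d"
    \<comment> \<open>For empty \<open>A\<close> truncated and integer subtraction differ, but both
      products are 0.\<close>
    by (cases "card A") (auto simp: algebra_simps)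
next
  assume "[CARD('p) = 1] (mod 4)"
  define n where "n = clique_number (paley_graph :: 'p mod_ring pair_pre_digraph)"
  have "CARD('p) > 2"
    using \<open>[CARD('p) = 1] (mod 4)\<close> prime_gt_1_nat[OF prime_card[where ?'a = 'p]]
    by (cases "CARD('p) = 2") (auto simp: cong_def)
  hence "n * (n - 1) \<le> (CARD('p) - 1) div 2"
    unfolding n_def by (rule paley_clique_number_bound)
  hence "2 * (n * (n - 1)) + 1 \<le> CARD('p)" using \<open>CARD('p) > 2\<close> by linarith
  hence "real (2 * (n * (n - 1)) + 1) \<le> real CARD('p)" by (rule of_nat_mono)
  \<comment> \<open>Completing the square:
    \<open>(2 * n - 1) ^ 2 = 2 * (2 * n * (n - 1) + 1) - 1\<close>. The case \<open>n = 0\<close> is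
    separate because \<open>n - 1\<close> was truncated.\<close>
  hence "(2 * real n - 1) ^ 2 \<le> 2 * real CARD('p) - 1"
    by (cases n) (auto simp: power2_eq_square algebra_simps)
  hence "2 * real n - 1 \<le> sqrt (2 * real CARD('p) - 1)" by (rule real_le_rsqrt)
  thus "real (clique_number (paley_graph :: 'p mod_ring pair_pre_digraph))
          \<le> (sqrt (2 * real CARD('p) - 1) + 1) / 2"
    by (simp add: n_def)
qed

end
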